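(* Let $\delta$ be the royal tangent $$\delta=\left((2z,z^2),\,2c(1,z)\right)$$ to the symmetrized bidisc $G$, for some $z\in\mathbb{D}$ and $c\in\mathbb{C}\setminus\{0\}$. A function $\varphi\in\mathbb{D}(G)$ solves $\mathrm{Car}\,\delta$ if and only if there exist an automorphism $m$ of $\mathbb{D}$ and a function $\Psi\in\mathcal{S}(G)$ such that, for all $s=(s^1,s^2)\in G$, $$\varphi(s)=m\left(\tfrac12 s^1+\tfrac14\left((s^1)^2-4s^2\right)\frac{\Psi(s)}{1-\tfrac12 s^1\Psi(s)}\right).$$
   Context: $\mathbb{D}$ is the open unit disc in $\mathbb{C}$. The symmetrized bidisc is the domain $G=\{(z+w,zw): |z|<1,\ |w|<1\}\subset\mathbb{C}^2$, with coordinates $(s^1,s^2)$ (superscripts are indices, so $(s^1)^2$ is the square of the first coordinate). A tangent to $G$ is a pair $\delta=(\lambda,v)$ with $\lambda\in G$ and $v\in\mathbb{C}^2$. $\mathbb{D}(G)$ is the set of holomorphic maps from $G$ to $\mathbb{D}$, and the Schur class $\mathcal{S}(G)$ is the set of holomorphic maps from $G$ to the closed unit disc. For $F\in\mathbb{D}(G)$, $D_vF(\lambda)$ is the complex directional derivative $v_1\,\partial F/\partial s^1(\lambda)+v_2\,\partial F/\partial s^2(\lambda)$. Define $$|\delta|_{\rm car}=\sup_{F\in\mathbb{D}(G)}\frac{|D_vF(\lambda)|}{1-|F(\lambda)|^2}.$$ A function $F\in\mathbb{D}(G)$ is said to solve the Carathéodory extremal problem $\mathrm{Car}\,\delta$ if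 this supremum is attained at $F$. An automorphism of $\mathbb{D}$ is a biholomorphic self-map of $\mathbb{D}$. *)

theory Defs
  imports "HOL-Complex_Analysis.Complex_Analysis" "HOL-Library.Extended_Real"
begin

abbreviation unit_disc :: "complex set"
  where "unit_disc \<equiv> ball 0 1"

definition symmetrized_bidisc :: "(complex \<times> complex) set"
  where "symmetrized_bidisc = {(z + w, z * w) | z w. norm z < 1 \<and> norm w < 1}"

text \<open>
  Holomorphy of a function of two complex variables, for an open set \<open>U\<close>: the function has a
  Frechet derivative at every point of \<open>U\<close>, and this derivative is complex linear, i.e. of the
  form \<open>(v\<^sub>1, v\<^sub>2) \<mapsto> a v\<^sub>1 + b v\<^sub>2\<close> (the derivative \<open>has_derivative\<close> is by itself only real linear).
\<close>

definition holomorphic2_on :: "(complex \<times> complex \<Rightarrow> complex) \<Rightarrow> (complex \<times> complex) set \<Rightarrow> bool"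
    (infixl \<open>(holomorphic2'_on)\<close> 50)
  where "F holomorphic2_on U \<longleftrightarrow>
    (\<forall>x\<in>U. \<exists>a b. (F has_derivative (\<lambda>v. a * fst v + b * snd v)) (at x within U))"

definition disc_valued :: "(complex \<times> complex) set \<Rightarrow> (complex \<times> complex \<Rightarrow> complex) set"
  where "disc_valued U = {F. F holomorphic2_on U \<and> F ` U \<subseteq> unit_disc}"

definition schur_class :: "(complex \<times> complex) set \<Rightarrow> (complex \<times> complex \<Rightarrow> complex) set"
  where "schur_class U = {F. F holomorphic2_on U \<and> F ` U \<subseteq> cball 0 1}"

definition dir_deriv ::
    "complex \<times> complex \<Rightarrow> (complex \<times> complex \<Rightarrow> complex) \<Rightarrow> complex \<times> complex \<Rightarrow> complex"
  where "dir_deriv v F p =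
    fst v * deriv (\<lambda>t. F (t, snd p)) (fst p) + snd v * deriv (\<lambda>t. F (fst p, t)) (snd p)"

text \<open>Base point and direction; that the base point lies in the domain is not part of the type.\<close>

type_synonym tangent = "(complex \<times> complex) \<times> (complex \<times> complex)"

definition car_quotient :: "tangent \<Rightarrow> (complex \<times> complex \<Rightarrow> complex) \<Rightarrow> real"
  where "car_quotient \<delta> F =
    norm (dir_deriv (snd \<delta>) F (fst \<delta>)) / (1 - (norm (F (fst \<delta>)))\<^sup>2)"

text \<open>
  The supremum is taken in the extended reals, so that it is the actual least upper bound
  without a prior proof that the quotients are bounded.
\<close>

definition car_norm :: "tangent \<Rightarrow> ereal"
  where "car_norm \<delta> = (SUP F \<in> disc_valued symmetrized_bidisc. ereal (car_quotient \<delta> F))"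

definition solves_Car :: "(complex \<times> complex \<Rightarrow> complex) \<Rightarrow> tangent \<Rightarrow> bool"
  where "solves_Car F \<delta> \<longleftrightarrow>
    F \<in> disc_valued symmetrized_bidisc \<and> ereal (car_quotient \<delta> F) = car_norm \<delta>"

definition disc_automorphism :: "(complex \<Rightarrow> complex) \<Rightarrow> bool"
  where "disc_automorphism m \<longleftrightarrow>
    m holomorphic_on unit_disc \<and> bij_betw m unit_disc unit_disc \<and>
    inv_into unit_disc m holomorphic_on unit_disc"

end

theory Submission
  imports Defs "HOL-Real_Asymp.Real_Asymp"
begin

text \<open>
  On the royal variety \<open>s\<^sup>2 = 4 p\<close>, parametrised by \<open>t \<mapsto> (2 t, t\<^sup>2)\<close>, the extremal problem is the
  infinitesimal Schwarz--Pick problem for \<open>f t = \<phi> (2 t, t\<^sup>2)\<close>; hence \<open>\<phi>\<close> is extremal iff \<open>f\<close> is an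
  automorphism of the disc. In that case \<open>F = f\<^sup>-\<^sup>1 \<circ> \<phi>\<close> satisfies \<open>F (2 t, t\<^sup>2) = t\<close>, and solving the
  required formula for \<open>\<Psi>\<close> gives \<open>\<Psi> = (s / 2 - F) / (p - F s / 2)\<close>.

  To see \<open>\<bar>\<Psi>\<bar> \<le> 1\<close>, note that through every point of \<open>G\<close> passes a flat geodesic
  \<open>l \<mapsto> (\<beta> + cnj \<beta> l, l)\<close>, which meets the royal variety at some \<open>(2 t, t\<^sup>2)\<close>. Schwarz--Pick for \<open>F\<close>
  along this disc, between \<open>t\<^sup>2\<close> and \<open>p\<close>, is equivalent to \<open>\<bar>s / 2 - F\<bar> \<le> \<bar>p - F s / 2\<bar>\<close>. The
  inequality also shows that the denominator vanishes only on the royal variety, across which \<open>\<Psi>\<close>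
  extends by a bounded removable singularity theorem.
\<close>

section \<open>The Schwarz--Pick lemma and disc automorphisms\<close>

text \<open>The disc automorphism normalised to vanish at \<open>a\<close>, with inverse
  \<open>blaschke (- a)\<close>; \<open>norm (blaschke a w)\<close> is the pseudohyperbolic distance
  between \<open>a\<close> and \<open>w\<close>.\<close>

definition blaschke :: "complex \<Rightarrow> complex \<Rightarrow> complex"
  where "blaschke a w = (w - a) / (1 - cnj a * w)"

lemma one_minus_cnj_mult_nonzero:
  fixes a w :: complex
  assumes "norm a < 1" "norm w < 1"
  shows "1 - cnj a * w \<noteq> 0"
proof
  assume "1 - cnj a * w = 0"
  hence "norm (cnj a * w) = 1" by (metis eq_iff_diff_eq_0 norm_one)
  moreover have "norm (cnj a * w) < 1"
    using assms by (simp add: norm_mult) (metis mult.right_neutral mult_strict_mono' norm_ge_zero)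
  ultimately show False by simp
qed

text \<open>For \<open>a\<close> and \<open>w\<close> in the disc the right-hand side is positive,
  which is what keeps \<open>blaschke a w\<close> in the disc.\<close>

lemma norm_blaschke_identity:
  "(norm (1 - cnj a * w))\<^sup>2 - (norm (w - a))\<^sup>2 = (1 - (norm a)\<^sup>2) * (1 - (norm w)\<^sup>2)"
  unfolding cmod_power2 by (simp add: power2_eq_square algebra_simps)

lemma norm_blaschke_less_1:
  assumes "norm a < 1" "norm w < 1"
  shows "norm (blaschke a w) < 1"
proof -
  have "0 < (1 - (norm a)\<^sup>2) * (1 - (norm w)\<^sup>2)"
    using assms by (simp add: power_less_one_iff)
  hence "(norm (w - a))\<^sup>2 < (norm (1 - cnj a * w))\<^sup>2"
    using norm_blaschke_identity[of a w] by linarith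
  hence "norm (w - a) < norm (1 - cnj a * w)" by (rule power2_less_imp_less) simp
  thus ?thesis using one_minus_cnj_mult_nonzero[OF assms]
    by (simp add: blaschke_def norm_divide divide_less_eq)
qed

lemma blaschke_blaschke:
  assumes "norm a < 1" "norm w < 1"
  shows "blaschke (- a) (blaschke a w) = w"
proof -
  have nz: "1 - cnj a * w \<noteq> 0" "1 - cnj a * a \<noteq> 0"
    using one_minus_cnj_mult_nonzero assms by blast+
  have "blaschke a w + a = w * (1 - cnj a * a) / (1 - cnj a * w)"
    using nz by (simp add: blaschke_def field_simps)
  moreover have "1 + cnj a * blaschke a w = (1 - cnj a * a) / (1 - cnj a * w)"
    using nz by (simp add: blaschke_def field_simps)
  ultimately show ?thesis using nz by (simp add: blaschke_def[of "-a"])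
qed

lemma blaschke_self [simp]: "blaschke a a = 0"
  by (simp add: blaschke_def)

lemma has_field_derivative_blaschke:
  assumes "norm a < 1" "norm w < 1"
  shows "(blaschke a has_field_derivative (1 - cnj a * a) / (1 - cnj a * w)\<^sup>2) (at w)"
proof -
  have nz: "1 - cnj a * w \<noteq> 0" using one_minus_cnj_mult_nonzero assms by blast
  show ?thesis unfolding blaschke_def
    by (rule derivative_eq_intros refl nz)+ (use nz in \<open>simp add: power2_eq_square algebra_simps\<close>)
qed

lemma holomorphic_on_blaschke: "norm a < 1 \<Longrightarrow> blaschke a holomorphic_on ball 0 1"
  unfolding holomorphic_on_open[OF open_ball] using has_field_derivative_blaschke
  by (metis mem_ball_0)

lemma one_minus_cnj_mult_self: "1 - cnj a * a = of_real (1 - (norm a)\<^sup>2)"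
  using complex_norm_square[of a] by (simp add: mult.commute)

text \<open>Moebius maps move \<open>z\<close> and \<open>f z\<close> to the origin, which puts
  \<open>f\<close> in the position required by Schwarz's lemma. In the chain rule at 0 the inner map
  contributes the factor \<open>1 - (norm z)^2\<close>, the outer one the factor
  \<open>1 / (1 - (norm (f z))^2)\<close>.\<close>

lemma Schwarz_Pick_aux:
  fixes f :: "complex \<Rightarrow> complex"
  assumes holf: "f holomorphic_on ball 0 1" and f: "f ` ball 0 1 \<subseteq> ball 0 1"
    and z: "norm z < 1"
  defines "g \<equiv> \<lambda>w. blaschke (f z) (f (blaschke (- z) w))"
  shows "g holomorphic_on ball 0 1" "g 0 = 0" "\<And>w. norm w < 1 \<Longrightarrow> norm (g w) < 1"
    and "norm (deriv g 0) = norm (deriv f z) * (1 - (norm z)\<^sup>2) / (1 - (norm (f z))\<^sup>2)"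
    and "\<And>w. norm w < 1 \<Longrightarrow> g (blaschke z w) = blaschke (f z) (f w)"
proof -
  have f1: "norm (f w) < 1" if "norm w < 1" for w
    using f that by force
  have bz: "norm (blaschke (-z) w) < 1" if "norm w < 1" for w
    using norm_blaschke_less_1[of "-z" w] that z by simp
  have 1: "(\<lambda>w. f (blaschke (-z) w)) holomorphic_on ball 0 1"
    using holomorphic_on_compose_gen[OF holomorphic_on_blaschke[of "-z"] holf] z bz
    unfolding o_def by force
  show "g holomorphic_on ball 0 1"
    using holomorphic_on_compose_gen[OF 1 holomorphic_on_blaschke[of "f z"]] f1 z bz
    unfolding o_def g_def by force
  have b0: "blaschke (-z) 0 = z" by (simp add: blaschke_def)
  show "g 0 = 0" by (simp add: g_def b0)
  show "norm (g w) < 1" if "norm w < 1" for w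
    unfolding g_def using norm_blaschke_less_1 f1 bz that z by blast
  show "g (blaschke z w) = blaschke (f z) (f w)" if "norm w < 1" for w
    unfolding g_def using blaschke_blaschke[OF z that] by simp
  have d1: "(blaschke (-z) has_field_derivative of_real (1 - (norm z)\<^sup>2)) (at 0)"
    using has_field_derivative_blaschke[of "-z" 0] z one_minus_cnj_mult_self[of z] by simp
  have d2: "(f has_field_derivative deriv f z) (at (blaschke (-z) 0))"
    using holomorphic_derivI[OF holf] z b0 by auto
  have fz: "norm (f z) < 1" using f1 z by simp
  have nz: "1 - (norm (f z))\<^sup>2 \<noteq> 0" using fz by (smt (verit) norm_ge_zero power2_eq_1_iff)
  have "(blaschke (f z) has_field_derivative (1 - cnj (f z) * f z) / (1 - cnj (f z) * f z)\<^sup>2)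
     (at (f (blaschke (-z) 0)))"
    unfolding b0 by (rule has_field_derivative_blaschke[OF fz fz])
  hence d3: "(blaschke (f z) has_field_derivative 1 / of_real (1 - (norm (f z))\<^sup>2))
     (at (f (blaschke (-z) 0)))"
    unfolding one_minus_cnj_mult_self using nz by (simp add: power2_eq_square del: of_real_diff)
  have "(g has_field_derivative 1 / of_real (1 - (norm (f z))\<^sup>2) * (deriv f z * of_real (1 - (norm z)\<^sup>2))) (at 0)"
    unfolding g_def by (rule DERIV_chain2[OF d3 DERIV_chain2[OF d2 d1]])
  hence "deriv g 0 = 1 / of_real (1 - (norm (f z))\<^sup>2) * (deriv f z * of_real (1 - (norm z)\<^sup>2))"
    by (rule DERIV_imp_deriv)
  moreover have "(norm (f z))\<^sup>2 < 1" "(norm z)\<^sup>2 < 1" using fz z by (simp_all add: power_less_one_iff)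
  ultimately show "norm (deriv g 0) = norm (deriv f z) * (1 - (norm z)\<^sup>2) / (1 - (norm (f z))\<^sup>2)"
    by (simp add: norm_mult norm_divide del: of_real_diff)
qed

text \<open>Both parts are Schwarz's lemma for the normalised map \<open>g\<close>: the first at the
  point \<open>blaschke z w\<close>, the second for the derivative at 0.\<close>

lemma Schwarz_Pick:
  fixes f :: "complex \<Rightarrow> complex"
  assumes holf: "f holomorphic_on ball 0 1" and f: "f ` ball 0 1 \<subseteq> ball 0 1"
    and z: "norm z < 1"
  shows "norm w < 1 \<Longrightarrow> norm (blaschke (f z) (f w)) \<le> norm (blaschke z w)"
    and "norm (deriv f z) / (1 - (norm (f z))\<^sup>2) \<le> 1 / (1 - (norm z)\<^sup>2)"
proof -
  note aux = Schwarz_Pick_aux[OF holf f z]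
  show "norm (blaschke (f z) (f w)) \<le> norm (blaschke z w)" if "norm w < 1"
    using Schwarz_Lemma(1)[OF aux(1,2) _ norm_blaschke_less_1[OF z that]] aux(3,5) that by auto
  have "norm (deriv f z) * (1 - (norm z)\<^sup>2) / (1 - (norm (f z))\<^sup>2) \<le> 1"
    using Schwarz_Lemma(2)[OF aux(1,2), of 0] aux(3,4) by auto
  moreover have "(norm z)\<^sup>2 < 1" using z by (simp add: power_less_one_iff)
  ultimately show "norm (deriv f z) / (1 - (norm (f z))\<^sup>2) \<le> 1 / (1 - (norm z)\<^sup>2)"
    by (simp add: field_simps)
qed

text \<open>An explicit inverse \<open>k\<close> agrees with \<open>inv_into unit_disc f\<close> on
  the disc, so its holomorphy carries over.\<close>

lemma disc_automorphismI:
  assumes "f holomorphic_on ball 0 1" "k holomorphic_on ball 0 1"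
    and "\<And>w. norm w < 1 \<Longrightarrow> norm (f w) < 1" "\<And>w. norm w < 1 \<Longrightarrow> norm (k w) < 1"
    and "\<And>w. norm w < 1 \<Longrightarrow> k (f w) = w" "\<And>w. norm w < 1 \<Longrightarrow> f (k w) = w"
  shows "disc_automorphism f"
proof -
  have bij: "bij_betw f unit_disc unit_disc"
    by (rule bij_betw_byWitness[where f' = k]) (use assms in auto)
  have "inv_into unit_disc f w = k w" if "w \<in> unit_disc" for w
    by (rule inv_into_f_eq) (use assms that bij in \<open>auto simp: bij_betw_def\<close>)
  hence "inv_into unit_disc f holomorphic_on unit_disc"
    using holomorphic_cong[of unit_disc unit_disc "inv_into unit_disc f" k] assms(2) by auto
  thus ?thesis using assms(1) bij by (simp add: disc_automorphism_def)
qed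

text \<open>Equality says that the normalised map has derivative of modulus 1 at 0, hence is a
  rotation; undoing the Moebius maps exhibits \<open>f\<close> as a composition of invertible
  maps.\<close>

lemma Schwarz_Pick_equality:
  fixes f :: "complex \<Rightarrow> complex"
  assumes holf: "f holomorphic_on ball 0 1" and f: "f ` ball 0 1 \<subseteq> ball 0 1"
    and z: "norm z < 1"
    and eq: "norm (deriv f z) / (1 - (norm (f z))\<^sup>2) = 1 / (1 - (norm z)\<^sup>2)"
  shows "disc_automorphism f"
proof -
  note aux = Schwarz_Pick_aux[OF holf f z]
  define a where "a = f z"
  have f1: "norm (f w) < 1" if "norm w < 1" for w
    using f that by force
  have a: "norm a < 1" using f1 z by (simp add: a_def)
  have "(norm z)\<^sup>2 < 1" using z by (simp add: power_less_one_iff)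
  hence "norm (deriv f z) * (1 - (norm z)\<^sup>2) / (1 - (norm (f z))\<^sup>2) = 1"
    using eq by (simp add: field_simps)
  hence "norm (deriv (\<lambda>w. blaschke (f z) (f (blaschke (- z) w))) 0) = 1"
    unfolding aux(4) .
  hence "\<exists>\<alpha>. (\<forall>w. norm w < 1 \<longrightarrow> blaschke (f z) (f (blaschke (- z) w)) = \<alpha> * w) \<and> norm \<alpha> = 1"
    using Schwarz_Lemma(3)[OF aux(1,2), of 0] aux(3) by auto
  then obtain \<alpha> where \<alpha>: "norm \<alpha> = 1" and
    "\<And>w. norm w < 1 \<Longrightarrow> blaschke (f z) (f (blaschke (- z) w)) = \<alpha> * w"
    by blast
  hence \<alpha>f: "\<alpha> * blaschke z w = blaschke a (f w)" if "norm w < 1" for w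
    using aux(5)[OF that] norm_blaschke_less_1[OF z that] by (simp add: a_def)
  \<comment> \<open>Obtained by solving \<open>\<alpha> * blaschke z v = blaschke a w\<close> for
    \<open>v\<close>, where \<open>cnj \<alpha>\<close> is the inverse of
    \<open>\<alpha>\<close>.\<close>
  define k where "k = (\<lambda>w. blaschke (-z) (cnj \<alpha> * blaschke a w))"
  have \<alpha>1: "cnj \<alpha> * \<alpha> = 1" using \<alpha> one_minus_cnj_mult_self[of \<alpha>] by simp
  have in1: "norm (cnj \<alpha> * blaschke a w) < 1" if "norm w < 1" for w
    using norm_blaschke_less_1[OF a that] \<alpha> by (simp add: norm_mult)
  have nk: "norm (k w) < 1" if "norm w < 1" for w
    unfolding k_def using norm_blaschke_less_1 in1[OF that] z by simp
  show ?thesis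
  proof (rule disc_automorphismI[OF holf _ f1 nk])
    have "(\<lambda>w. cnj \<alpha> * blaschke a w) holomorphic_on ball 0 1"
      using holomorphic_on_blaschke[OF a] by (intro holomorphic_intros)
    from holomorphic_on_compose_gen[OF this holomorphic_on_blaschke[of "-z"]]
    show "k holomorphic_on ball 0 1" using z in1 unfolding o_def k_def by force
    fix w :: complex assume w: "norm w < 1"
    have "cnj \<alpha> * blaschke a (f w) = cnj \<alpha> * \<alpha> * blaschke z w"
      using \<alpha>f[OF w] by simp
    thus "k (f w) = w" unfolding k_def \<alpha>1 using blaschke_blaschke[OF z w] by simp
    have "blaschke z (k w) = cnj \<alpha> * blaschke a w"
      unfolding k_def using blaschke_blaschke[of "-z", OF _ in1[OF w]] z by simp
    hence "\<alpha> * blaschke z (k w) = cnj \<alpha> * \<alpha> * blaschke a w" by simp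
    hence "blaschke a (f (k w)) = blaschke a w"
      using \<alpha>f[OF nk[OF w]] \<alpha>1 by simp
    thus "f (k w) = w"
      using blaschke_blaschke[OF a f1[OF nk[OF w]]] blaschke_blaschke[OF a w] by simp
  qed
qed

lemma disc_automorphismD:
  assumes "disc_automorphism m"
  defines "k \<equiv> inv_into unit_disc m"
  shows "m holomorphic_on ball 0 1" "k holomorphic_on ball 0 1"
    and "\<And>w. norm w < 1 \<Longrightarrow> norm (m w) < 1" "\<And>w. norm w < 1 \<Longrightarrow> norm (k w) < 1"
    and "\<And>w. norm w < 1 \<Longrightarrow> k (m w) = w" "\<And>w. norm w < 1 \<Longrightarrow> m (k w) = w"
proof -
  have bij: "bij_betw m unit_disc unit_disc" using assms by (simp add: disc_automorphism_def)
  have bijk: "bij_betw k unit_disc unit_disc"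
    unfolding k_def by (rule bij_betw_inv_into[OF bij])
  show "m holomorphic_on ball 0 1" "k holomorphic_on ball 0 1"
    using assms by (simp_all add: disc_automorphism_def)
  show "norm (m w) < 1" if "norm w < 1" for w using bij_betwE[OF bij] that by auto
  show "norm (k w) < 1" if "norm w < 1" for w using bij_betwE[OF bijk] that by auto
  show "k (m w) = w" if "norm w < 1" for w
    using bij_betw_inv_into_left[OF bij] that by (simp add: k_def)
  show "m (k w) = w" if "norm w < 1" for w
    using bij_betw_inv_into_right[OF bij] that by (simp add: k_def)
qed

text \<open>The Schwarz-Pick bounds for \<open>m\<close> at \<open>z\<close> and for its inverse at
  \<open>m z\<close> have product 1, and so do the two derivatives by the chain rule; hence neither
  bound can be strict.\<close>

lemma disc_automorphism_Schwarz_Pick_equality: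
  assumes "disc_automorphism m" and z: "norm z < 1"
  shows "norm (deriv m z) / (1 - (norm (m z))\<^sup>2) = 1 / (1 - (norm z)\<^sup>2)"
proof -
  define k where "k = inv_into unit_disc m"
  note m = disc_automorphismD[OF assms(1), folded k_def]
  have mz: "norm (m z) < 1" using m z by simp
  have im: "m ` ball 0 1 \<subseteq> ball 0 1" "k ` ball 0 1 \<subseteq> ball 0 1"
    using m(3,4) by auto
  have "((\<lambda>w. k (m w)) has_field_derivative deriv k (m z) * deriv m z) (at z)"
    by (rule DERIV_chain2; rule holomorphic_derivI[OF _ open_ball]) (use m z in auto)
  hence "((\<lambda>w. w) has_field_derivative deriv k (m z) * deriv m z) (at z)"
    by (rule has_field_derivative_transform_within_open[of _ _ _ "ball 0 1"]) (use m z in auto)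
  hence 1: "deriv k (m z) * deriv m z = 1"
    using DERIV_ident DERIV_unique by blast
  define X Y where "X = 1 - (norm z)\<^sup>2" and "Y = 1 - (norm (m z))\<^sup>2"
  have pos: "X > 0" "Y > 0"
    using mz z by (simp_all add: X_def Y_def power_less_one_iff)
  have le1: "norm (deriv m z) * X \<le> Y"
    using Schwarz_Pick(2)[OF m(1) im(1) z] pos by (simp add: X_def[symmetric] Y_def[symmetric] field_simps)
  have le2: "norm (deriv k (m z)) * Y \<le> X"
    using Schwarz_Pick(2)[OF m(2) im(2) mz] pos m(5)[OF z]
    by (simp add: X_def[symmetric] Y_def[symmetric] field_simps)
  have "norm (deriv m z) * (norm (deriv k (m z)) * Y) \<le> norm (deriv m z) * X"
    using le2 by (rule mult_left_mono) simp
  moreover have "norm (deriv m z) * (norm (deriv k (m z)) * Y) = Y"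
    using 1 by (metis mult.assoc mult.commute mult.left_neutral norm_mult norm_one)
  ultimately have "norm (deriv m z) * X = Y" using le1 by linarith
  thus ?thesis using pos by (simp add: X_def[symmetric] Y_def[symmetric] field_simps)
qed

section \<open>Holomorphic functions of two variables\<close>

lemma holomorphic2_on_open:
  assumes "open U"
  shows "F holomorphic2_on U \<longleftrightarrow>
    (\<forall>x\<in>U. \<exists>a b. (F has_derivative (\<lambda>v. a * fst v + b * snd v)) (at x))"
proof -
  have "at x within U = at x" if "x \<in> U" for x using assms that by (rule at_within_open[rotated])
  thus ?thesis unfolding holomorphic2_on_def by simp
qed

lemma holomorphic2_on_const: "(\<lambda>_. c) holomorphic2_on U"
  unfolding holomorphic2_on_def
  by (intro ballI, rule exI[of _ 0], rule exI[of _ 0]) simp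

lemma holomorphic2_on_fst: "fst holomorphic2_on U"
  unfolding holomorphic2_on_def
  by (rule ballI, rule exI[of _ 1], rule exI[of _ 0])
    (simp add: bounded_linear_imp_has_derivative bounded_linear_fst)

lemma holomorphic2_on_snd: "snd holomorphic2_on U"
  unfolding holomorphic2_on_def
  by (rule ballI, rule exI[of _ 0], rule exI[of _ 1])
    (simp add: bounded_linear_imp_has_derivative bounded_linear_snd)

lemma holomorphic2_on_compose1:
  assumes F: "F holomorphic2_on U" and f: "f holomorphic_on S" "open S" and "F ` U \<subseteq> S"
  shows "(\<lambda>x. f (F x)) holomorphic2_on U"
  unfolding holomorphic2_on_def
proof
  fix x assume x: "x \<in> U"
  then obtain a b where ab: "(F has_derivative (\<lambda>v. a * fst v + b * snd v)) (at x within U)"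
    using F unfolding holomorphic2_on_def by blast
  have "(f has_derivative (\<lambda>h. deriv f (F x) * h)) (at (F x))"
    using holomorphic_derivI[OF f] assms(4) x by (auto simp: has_field_derivative_def)
  from has_derivative_compose[OF ab this]
  have "((\<lambda>x. f (F x)) has_derivative
      (\<lambda>v. (deriv f (F x) * a) * fst v + (deriv f (F x) * b) * snd v)) (at x within U)"
    by (simp add: algebra_simps)
  thus "\<exists>a b. ((\<lambda>x. f (F x)) has_derivative (\<lambda>v. a * fst v + b * snd v)) (at x within U)" by blast
qed

lemma holomorphic2_on_compose2:
  assumes "F holomorphic2_on V" "G1 holomorphic2_on U" "G2 holomorphic2_on U"
    and "\<And>x. x \<in> U \<Longrightarrow> (G1 x, G2 x) \<in> V" and "open V"
  shows "(\<lambda>x. F (G1 x, G2 x)) holomorphic2_on U"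
  unfolding holomorphic2_on_def
proof
  fix x assume x: "x \<in> U"
  then obtain a1 b1 where 1: "(G1 has_derivative (\<lambda>v. a1 * fst v + b1 * snd v)) (at x within U)"
    using assms(2) unfolding holomorphic2_on_def by blast
  obtain a2 b2 where 2: "(G2 has_derivative (\<lambda>v. a2 * fst v + b2 * snd v)) (at x within U)"
    using assms(3) x unfolding holomorphic2_on_def by blast
  obtain a b where 3: "(F has_derivative (\<lambda>v. a * fst v + b * snd v)) (at (G1 x, G2 x))"
    using assms(4)[OF x] assms(1,5) holomorphic2_on_open by blast
  from has_derivative_compose[OF has_derivative_Pair[OF 1 2] 3]
  have "((\<lambda>x. F (G1 x, G2 x)) has_derivative
      (\<lambda>v. (a * a1 + b * a2) * fst v + (a * b1 + b * b2) * snd v)) (at x within U)"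
    by (simp add: algebra_simps)
  thus "\<exists>a b. ((\<lambda>x. F (G1 x, G2 x)) has_derivative (\<lambda>v. a * fst v + b * snd v)) (at x within U)" by blast
qed

lemma holomorphic2_on_mult:
  assumes "F holomorphic2_on U" "G holomorphic2_on U"
  shows "(\<lambda>x. F x * G x) holomorphic2_on U"
  unfolding holomorphic2_on_def
proof
  fix x assume x: "x \<in> U"
  obtain a b where 1: "(F has_derivative (\<lambda>v. a * fst v + b * snd v)) (at x within U)"
    using assms(1) x unfolding holomorphic2_on_def by blast
  obtain c d where 2: "(G has_derivative (\<lambda>v. c * fst v + d * snd v)) (at x within U)"
    using assms(2) x unfolding holomorphic2_on_def by blast
  have "((\<lambda>x. F x * G x) has_derivative
      (\<lambda>v. (F x * c + a * G x) * fst v + (F x * d + b * G x) * snd v)) (at x within U)"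
    using has_derivative_mult[OF 1 2] by (simp add: algebra_simps)
  thus "\<exists>a b. ((\<lambda>x. F x * G x) has_derivative (\<lambda>v. a * fst v + b * snd v)) (at x within U)"
    by blast
qed

lemma holomorphic2_on_diff:
  assumes "F holomorphic2_on U" "G holomorphic2_on U"
  shows "(\<lambda>x. F x - G x) holomorphic2_on U"
  unfolding holomorphic2_on_def
proof
  fix x assume x: "x \<in> U"
  obtain a b where 1: "(F has_derivative (\<lambda>v. a * fst v + b * snd v)) (at x within U)"
    using assms(1) x unfolding holomorphic2_on_def by blast
  obtain c d where 2: "(G has_derivative (\<lambda>v. c * fst v + d * snd v)) (at x within U)"
    using assms(2) x unfolding holomorphic2_on_def by blast
  have "((\<lambda>x. F x - G x) has_derivative (\<lambda>v. (a - c) * fst v + (b - d) * snd v)) (at x within U)"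
    using has_derivative_diff[OF 1 2] by (simp add: algebra_simps)
  thus "\<exists>a b. ((\<lambda>x. F x - G x) has_derivative (\<lambda>v. a * fst v + b * snd v)) (at x within U)"
    by blast
qed

lemma holomorphic2_on_divide:
  assumes "F holomorphic2_on U" "G holomorphic2_on U" "\<And>x. x \<in> U \<Longrightarrow> G x \<noteq> 0"
  shows "(\<lambda>x. F x / G x) holomorphic2_on U"
proof -
  have "inverse holomorphic_on - {0}" by (auto intro!: holomorphic_intros)
  hence "(\<lambda>x. inverse (G x)) holomorphic2_on U"
    by (rule holomorphic2_on_compose1[OF assms(2)]) (use assms in auto)
  from holomorphic2_on_mult[OF assms(1) this] show ?thesis unfolding divide_inverse .
qed

lemma has_field_derivative_compose_pair:
  assumes "(F has_derivative (\<lambda>v. a * fst v + b * snd v)) (at (f t, g t))"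
    and "(f has_field_derivative f') (at t within S)" "(g has_field_derivative g') (at t within S)"
  shows "((\<lambda>t. F (f t, g t)) has_field_derivative a * f' + b * g') (at t within S)"
proof -
  from has_derivative_compose[OF has_derivative_Pair[OF assms(2,3)[unfolded has_field_derivative_def]] assms(1)]
  have "((\<lambda>t. F (f t, g t)) has_derivative (\<lambda>x. (a * f' + b * g') * x)) (at t within S)"
    by (simp add: algebra_simps)
  thus ?thesis unfolding has_field_derivative_def .
qed

lemma holomorphic_on_compose_pair:
  assumes "F holomorphic2_on U" "open U" "f holomorphic_on S" "g holomorphic_on S"
    and "\<And>t. t \<in> S \<Longrightarrow> (f t, g t) \<in> U"
  shows "(\<lambda>t. F (f t, g t)) holomorphic_on S"
  unfolding holomorphic_on_def field_differentiable_def
proof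
  fix t assume t: "t \<in> S"
  obtain a b where "(F has_derivative (\<lambda>v. a * fst v + b * snd v)) (at (f t, g t))"
    using assms(5)[OF t] assms(1,2) holomorphic2_on_open by blast
  moreover obtain f' g' where "(f has_field_derivative f') (at t within S)"
    "(g has_field_derivative g') (at t within S)"
    using assms(3,4) t unfolding holomorphic_on_def field_differentiable_def by blast
  ultimately show "\<exists>D. ((\<lambda>t. F (f t, g t)) has_field_derivative D) (at t within S)"
    by (blast intro: has_field_derivative_compose_pair)
qed

section \<open>Cauchy estimates and bounded separately holomorphic functions\<close>

text \<open>Cauchy's inequality on the circle of radius \<open>r/4\<close> about \<open>x\<close>.
  The closed disc it bounds stays in \<open>ball a r\<close> because \<open>r/2 + r/4 < r\<close>;
  this is the origin of the constant 4.\<close>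

lemma norm_deriv_le_half_ball:
  fixes f :: "complex \<Rightarrow> complex"
  assumes holf: "f holomorphic_on ball a r" and M: "\<And>w. w \<in> ball a r \<Longrightarrow> norm (f w) \<le> M"
    and x: "x \<in> ball a (r/2)"
  shows "norm (deriv f x) \<le> 4 * M / r"
proof -
  have r: "r > 0" using x by (smt (verit) half_gt_zero_iff mem_ball zero_le_dist)
  have sub: "cball x (r/4) \<subseteq> ball a r"
  proof
    fix w assume "w \<in> cball x (r/4)"
    thus "w \<in> ball a r" using x dist_triangle[of a w x] r by auto
  qed
  have "norm ((deriv ^^ 1) f x) \<le> fact 1 * M / (r/4) ^ 1"
  proof (rule Cauchy_inequality)
    show "f holomorphic_on ball x (r/4)"
      using holf sub by (meson ball_subset_cball holomorphic_on_subset order_trans)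
    show "continuous_on (cball x (r/4)) f"
      using holf sub by (meson holomorphic_on_imp_continuous_on continuous_on_subset)
    show "norm (f w) \<le> M" if "norm (x - w) = r/4" for w
      using that sub M by (metis dist_norm mem_cball order_refl subsetD)
  qed (use r in auto)
  thus ?thesis by (simp add: mult.commute)
qed

text \<open>The mean value inequality on the convex half ball, with the preceding derivative
  bound.\<close>

lemma bounded_holomorphic_Lipschitz_half_ball:
  fixes f :: "complex \<Rightarrow> complex"
  assumes holf: "f holomorphic_on ball a r" and M: "\<And>w. w \<in> ball a r \<Longrightarrow> norm (f w) \<le> M"
    and "x \<in> ball a (r/2)" "y \<in> ball a (r/2)"
  shows "norm (f x - f y) \<le> 4 * M / r * norm (x - y)"
proof (rule field_differentiable_bound[of "ball a (r/2)" f "deriv f"])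
  have r: "r > 0" using assms(3) by (smt (verit) half_gt_zero_iff mem_ball zero_le_dist)
  fix w assume w: "w \<in> ball a (r/2)"
  hence "w \<in> ball a r" using r by auto
  from holomorphic_derivI[OF holf open_ball this]
  show "(f has_field_derivative deriv f w) (at w within ball a (r/2))"
    by (rule has_field_derivative_at_within)
  show "norm (deriv f w) \<le> 4 * M / r" by (rule norm_deriv_le_half_ball[OF holf M w])
qed (use assms in auto)

text \<open>By Cauchy's estimates, boundedness makes \<open>h\<close> and then its second partial derivative
  Lipschitz in the first variable, locally uniformly in the second.\<close>

lemma has_derivative_separately_holomorphic:
  fixes h :: "complex \<Rightarrow> complex \<Rightarrow> complex"
  assumes r: "r > 0"
    and hol2: "\<And>x. x \<in> ball a r \<Longrightarrow> h x holomorphic_on ball b r"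
    and hol1: "\<And>y. y \<in> ball b r \<Longrightarrow> (\<lambda>x. h x y) holomorphic_on ball a r"
    and M: "\<And>x y. x \<in> ball a r \<Longrightarrow> y \<in> ball b r \<Longrightarrow> norm (h x y) \<le> M"
  shows "((\<lambda>(x, y). h x y) has_derivative
    (\<lambda>v. deriv (\<lambda>x. h x b) a * fst v + deriv (h a) b * snd v)) (at (a, b))"
proof -
  define X Y where "X = ball a (r/2)" and "Y = ball b (r/2)"
  have X: "x \<in> ball a r" if "x \<in> X" for x using that r by (auto simp: X_def)
  have Y: "y \<in> ball b r" if "y \<in> Y" for y using that r by (auto simp: Y_def)
  have ab: "a \<in> X" "b \<in> Y" using r by (auto simp: X_def Y_def)
  have at: "at (a, b) within X \<times> Y = at (a, b)"
    using ab by (intro at_within_open) (auto simp: X_def Y_def intro: open_Times)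
  have ev: "eventually (\<lambda>p. p \<in> X \<times> Y) (at (a, b))"
    by (rule eventually_at_in_open') (use ab in \<open>auto simp: X_def Y_def intro: open_Times\<close>)
  have bound: "norm (deriv (h x) y - deriv (h a) y) \<le> 4 * (4 * M / r * norm (x - a)) / r"
    if xy: "x \<in> X" "y \<in> Y" for x y
  proof -
    have "norm (deriv (\<lambda>w. h x w - h a w) y) \<le> 4 * (4 * M / r * norm (x - a)) / r"
    proof (rule norm_deriv_le_half_ball)
      show "(\<lambda>w. h x w - h a w) holomorphic_on ball b r"
        using hol2 X[OF xy(1)] X[OF ab(1)] by (intro holomorphic_intros) auto
      show "norm (h x w - h a w) \<le> 4 * M / r * norm (x - a)" if "w \<in> ball b r" for w
        by (rule bounded_holomorphic_Lipschitz_half_ball[OF hol1[OF that]])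
          (use M that xy ab X_def in auto)
      show "y \<in> ball b (r/2)" using xy by (simp add: Y_def)
    qed
    moreover have "deriv (\<lambda>w. h x w - h a w) y = deriv (h x) y - deriv (h a) y"
      by (rule deriv_diff; rule holomorphic_on_imp_differentiable_at[OF hol2 open_ball])
        (use X[OF xy(1)] X[OF ab(1)] Y[OF xy(2)] in auto)
    ultimately show ?thesis by simp
  qed
  \<comment> \<open>Joint continuity of the second partial derivative at \<open>(a, b)\<close> is
    split in two: changing \<open>fst p\<close> to \<open>a\<close> costs at most a multiple of
    \<open>norm (fst p - a)\<close> by \<open>bound\<close>, and \<open>deriv (h a)\<close> is
    continuous in one variable.\<close>
  have "((\<lambda>p. deriv (h (fst p)) (snd p) - deriv (h a) (snd p)) \<longlongrightarrow> 0) (at (a, b))"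
  proof (rule Lim_null_comparison)
    show "\<forall>\<^sub>F p in at (a, b). norm (deriv (h (fst p)) (snd p) - deriv (h a) (snd p))
        \<le> 4 * (4 * M / r * norm (fst p - a)) / r"
      using ev by eventually_elim (use bound in auto)
    show "((\<lambda>p. 4 * (4 * M / r * norm (fst p - a)) / r) \<longlongrightarrow> 0) (at (a, b))"
    proof -
      have "isCont (\<lambda>p. 4 * (4 * M / r * norm (fst p - a)) / r) (a, b)"
        using r by (intro continuous_intros) auto
      from isContD[OF this] show ?thesis by simp
    qed
  qed
  moreover have "((\<lambda>p. deriv (h a) (snd p)) \<longlongrightarrow> deriv (h a) b) (at (a, b))"
  proof (rule isCont_tendsto_compose[where g = "deriv (h a)" and f = snd])
    have "deriv (h a) holomorphic_on ball b r"
      using hol2 ab X by (intro holomorphic_deriv) auto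
    thus "isCont (deriv (h a)) b"
      using r by (metis centre_in_ball continuous_on_interior holomorphic_on_imp_continuous_on
          interior_open open_ball)
    show "(snd \<longlongrightarrow> b) (at (a, b))"
      using tendsto_snd[OF tendsto_ident_at, of "(a, b)" UNIV] by simp
  qed
  ultimately have "((\<lambda>p. deriv (h (fst p)) (snd p)) \<longlongrightarrow> deriv (h a) b) (at (a, b))"
    using tendsto_add by fastforce
  \<comment> \<open>The rule for partial derivatives used next wants the second partial as a bounded
    linear map, continuous in the operator norm, so the limit is lifted through
    \<open>blinfun_mult_right\<close>.\<close>
  hence lim: "((\<lambda>p. blinfun_mult_right (deriv (h (fst p)) (snd p))) \<longlongrightarrow>
      blinfun_mult_right (deriv (h a) b)) (at (a, b))"
    by (rule bounded_linear.tendsto[OF bounded_linear_blinfun_mult_right])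
  have "((\<lambda>(x, y). h x y) has_derivative
      (\<lambda>(tx, ty). deriv (\<lambda>x. h x b) a * tx + blinfun_mult_right (deriv (h a) b) ty))
      (at (a, b) within X \<times> Y)"
  proof (rule has_derivative_partialsI[where fy = "\<lambda>x y. blinfun_mult_right (deriv (h x) y)"])
    show "((\<lambda>x. h x b) has_derivative (*) (deriv (\<lambda>x. h x b) a)) (at a within X)"
      using holomorphic_derivI[OF hol1[OF Y[OF ab(2)]] open_ball X[OF ab(1)]]
      by (auto simp: has_field_derivative_def intro: has_derivative_at_withinI)
    show "(h x has_derivative blinfun_apply (blinfun_mult_right (deriv (h x) y))) (at y within Y)"
      if "x \<in> X" "y \<in> Y" for x y
      using holomorphic_derivI[OF hol2[OF X[OF that(1)]] open_ball Y[OF that(2)]]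
      by (auto simp: has_field_derivative_def blinfun_mult_right.rep_eq intro: has_derivative_at_withinI)
    show "continuous (at (a, b) within X \<times> Y) (\<lambda>(x, y). blinfun_mult_right (deriv (h x) y))"
      unfolding at continuous_at case_prod_unfold using lim by simp
  qed (use ab in \<open>auto simp: Y_def\<close>)
  moreover have "(\<lambda>(tx, ty). deriv (\<lambda>x. h x b) a * tx + blinfun_mult_right (deriv (h a) b) ty)
      = (\<lambda>v. deriv (\<lambda>x. h x b) a * fst v + deriv (h a) b * snd v)"
    by (rule ext) (simp add: blinfun_mult_right.rep_eq split_beta)
  ultimately show ?thesis unfolding at by simp
qed


section \<open>Bounded extension across a complex line\<close>

text \<open>Riemann's theorem extends each slice in the second variable. On the line
  \<open>snd x = 0\<close> the extension is a locally uniform limit of holomorphic functions of the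
  first variable, so it is bounded and separately holomorphic, hence jointly differentiable.\<close>

lemma holomorphic2_extend_bounded:
  assumes U: "open U" and g: "g holomorphic2_on {x \<in> U. snd x \<noteq> 0}"
    and bound: "\<And>x. x \<in> U \<Longrightarrow> snd x \<noteq> 0 \<Longrightarrow> norm (g x) \<le> B"
  obtains h where "h holomorphic2_on U" "\<And>x. x \<in> U \<Longrightarrow> norm (h x) \<le> B"
    "\<And>x. x \<in> U \<Longrightarrow> snd x \<noteq> 0 \<Longrightarrow> h x = g x"
proof
  \<comment> \<open>\<open>Lim\<close> is a total function; that the limit along the slice really
    exists comes out of the proof of \<open>hol2\<close>.\<close>
  define h where "h = (\<lambda>x. if snd x = 0 then Lim (at 0) (\<lambda>q. g (fst x, q)) else g x)"
  define U' where "U' = {x \<in> U. snd x \<noteq> 0}"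
  have "U' = U \<inter> snd -` (- {0})" by (auto simp: U'_def)
  hence U': "open U'" using open_Int[OF U open_vimage_snd[OF open_Compl[OF closed_singleton[of 0]]]] by metis
  note g = g[folded U'_def]
  show hg: "h x = g x" if "x \<in> U" "snd x \<noteq> 0" for x using that by (simp add: h_def)
  have local: "norm (h (a, 0)) \<le> B \<and>
      (\<exists>d e. (h has_derivative (\<lambda>v. d * fst v + e * snd v)) (at (a, 0)))"
    if aU: "(a, 0) \<in> U" for a
  proof -
    obtain A1 A2 where A: "open A1" "open A2" "(a, 0) \<in> A1 \<times> A2" "A1 \<times> A2 \<subseteq> U"
      using open_prod_elim[OF U aU] by blast
    obtain r1 r2 where r12: "r1 > 0" "r2 > 0" "ball a r1 \<subseteq> A1" "ball 0 r2 \<subseteq> A2"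
      using A by (metis mem_Sigma_iff openE)
    define r where "r = min r1 r2"
    have r: "r > 0" using r12 by (simp add: r_def)
    have sub: "(u, q) \<in> U" if "u \<in> ball a r" "q \<in> ball 0 r" for u q
    proof -
      have "u \<in> ball a r1" "q \<in> ball 0 r2" using that by (auto simp: r_def)
      thus ?thesis using A(4) r12(3,4) by blast
    qed
    \<comment> \<open>The one-variable removable singularity theorem supplies \<open>k\<close>; its
      value at 0 is the limit that defines \<open>h (u, 0)\<close>, so \<open>h\<close> coincides
      with \<open>k\<close> on the whole slice.\<close>
    have hol2: "(\<lambda>q. h (u, q)) holomorphic_on ball 0 r" if u: "u \<in> ball a r" for u
    proof -
      have 1: "(\<lambda>q. g (u, q)) holomorphic_on (ball 0 r - {0})"
        by (rule holomorphic_on_compose_pair[OF g U'])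
          (use sub u in \<open>auto intro!: holomorphic_intros simp: U'_def\<close>)
      have "\<forall>\<^sub>F q in at 0. norm (g (u, q)) \<le> B"
        using eventually_at_in_open[OF open_ball, of 0 0 r]
        by (auto simp: r elim!: eventually_mono intro!: bound sub u)
      then obtain k where k: "k holomorphic_on ball 0 r" "\<And>q. q \<in> ball 0 r - {0} \<Longrightarrow> k q = g (u, q)"
        using holomorphic_on_extend_bounded[OF 1] r by auto
      have "(k \<longlongrightarrow> k 0) (at 0)"
        using k(1) r by (metis centre_in_ball continuous_on_interior holomorphic_on_imp_continuous_on
            interior_open isContD open_ball)
      hence "((\<lambda>q. g (u, q)) \<longlongrightarrow> k 0) (at 0)"
        by (rule Lim_transform_within_open[where s = "ball 0 r"]) (use k r in auto)
      hence "h (u, 0) = k 0" by (simp add: h_def tendsto_Lim)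
      hence "h (u, q) = k q" if "q \<in> ball 0 r" for q
        using that k(2)[of q] by (cases "q = 0") (auto simp: h_def)
      thus ?thesis using k(1) by (metis (no_types, lifting) holomorphic_cong)
    qed
    have hB: "norm (h (u, q)) \<le> B" if "u \<in> ball a r" "q \<in> ball 0 r" for u q
    proof (cases "q = 0")
      case False
      thus ?thesis using bound[OF sub[OF that]] by (simp add: h_def)
    next
      case True
      have "((\<lambda>q. h (u, q)) \<longlongrightarrow> h (u, 0)) (at 0)"
        using hol2[OF that(1)] r by (metis centre_in_ball continuous_on_interior
            holomorphic_on_imp_continuous_on interior_open isContD open_ball)
      moreover have "\<forall>\<^sub>F q in at 0. norm (h (u, q)) \<le> B"
        using eventually_at_in_open[OF open_ball, of 0 0 r]
        by (auto simp: r h_def elim!: eventually_mono intro!: bound sub that)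
      ultimately show ?thesis unfolding True by (intro Lim_norm_ubound[of "at 0"]) auto
    qed
    have hol1': "(\<lambda>u. h (u, q)) holomorphic_on ball a r" if "q \<in> ball 0 r" "q \<noteq> 0" for q
    proof -
      have "(\<lambda>u. g (u, q)) holomorphic_on ball a r"
        by (rule holomorphic_on_compose_pair[OF g U'])
          (use sub that in \<open>auto intro!: holomorphic_intros simp: U'_def\<close>)
      thus ?thesis using that by (simp add: h_def)
    qed
    \<comment> \<open>A sequence of nonzero points tending to 0. The summand 3 gives
      \<open>norm (q n) \<le> r / 3\<close>, so that every \<open>q n\<close> lies in the half ball
      where the Lipschitz bound holds.\<close>
    define q where "q = (\<lambda>n. complex_of_real (r / (real n + 3)))"
    have q: "q n \<in> ball 0 (r/2)" "q n \<noteq> 0" "norm (q n) = r / (real n + 3)" for n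
      using r by (auto simp: q_def norm_divide field_simps add_pos_nonneg simp flip: of_real_add of_real_divide)
    have "(\<lambda>u. h (u, 0)) holomorphic_on ball a r"
    proof (rule holomorphic_uniform_sequence[OF open_ball])
      show "(\<lambda>u. h (u, q n)) holomorphic_on ball a r" for n
        using q(1,2)[of n] r by (intro hol1') auto
      fix x assume "x \<in> ball a r"
      then obtain d where d: "d > 0" "cball x d \<subseteq> ball a r"
        using open_contains_cball open_ball by blast
      \<comment> \<open>The Lipschitz constant \<open>4 * B / r\<close> in the second variable does
        not depend on \<open>u\<close>, which makes the convergence uniform.\<close>
      have "uniform_limit (cball x d) (\<lambda>n u. h (u, q n)) (\<lambda>u. h (u, 0)) sequentially"
      proof (rule uniform_limitI)
        fix e :: real assume "e > 0"
        have "(\<lambda>n. 4 * B / r * (r / (real n + 3))) \<longlonglongrightarrow> 0" by real_asymp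
        hence "\<forall>\<^sub>F n in sequentially. 4 * B / r * (r / (real n + 3)) < e"
          using \<open>e > 0\<close> by (rule order_tendstoD)
        thus "\<forall>\<^sub>F n in sequentially. \<forall>u\<in>cball x d. dist (h (u, q n)) (h (u, 0)) < e"
        proof eventually_elim
          case (elim n)
          show ?case
          proof
            fix u assume "u \<in> cball x d"
            hence u: "u \<in> ball a r" using d by auto
            have "norm (h (u, q n) - h (u, 0)) \<le> 4 * B / r * norm (q n - 0)"
              by (rule bounded_holomorphic_Lipschitz_half_ball[OF hol2[OF u] hB[OF u]])
                (use q r in auto)
            thus "dist (h (u, q n)) (h (u, 0)) < e"
              using elim q(3)[of n] by (simp add: dist_norm)
          qed
        qed
      qed
      thus "\<exists>d>0. cball x d \<subseteq> ball a r \<and>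
          uniform_limit (cball x d) (\<lambda>n u. h (u, q n)) (\<lambda>u. h (u, 0)) sequentially"
        using d by blast
    qed
    hence hol1: "(\<lambda>u. h (u, q)) holomorphic_on ball a r" if "q \<in> ball 0 r" for q
      using hol1' that by (cases "q = 0") auto
    from has_derivative_separately_holomorphic[OF r, of a "\<lambda>u q. h (u, q)", OF hol2 hol1 hB]
    show ?thesis using hB[of a 0] r by auto
  qed
  show "norm (h x) \<le> B" if "x \<in> U" for x
    using that local bound by (cases x; cases "snd x = 0") (auto simp: h_def)
  show "h holomorphic2_on U"
    unfolding holomorphic2_on_open[OF U]
  proof
    fix x assume x: "x \<in> U"
    show "\<exists>a b. (h has_derivative (\<lambda>v. a * fst v + b * snd v)) (at x)"
    proof (cases "snd x = 0")
      case True
      thus ?thesis using local[of "fst x"] x by (cases x) auto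
    next
      case False
      hence x': "x \<in> U'" using x by (simp add: U'_def)
      then obtain a b where "(g has_derivative (\<lambda>v. a * fst v + b * snd v)) (at x)"
        using g holomorphic2_on_open[OF U'] by blast
      hence "(h has_derivative (\<lambda>v. a * fst v + b * snd v)) (at x)"
        by (rule has_derivative_transform_within_open[OF _ U' x']) (simp add: U'_def h_def)
      thus ?thesis by blast
    qed
  qed
qed

section \<open>The symmetrized bidisc\<close>

text \<open>The coefficients on the right are real, so the triangle inequality and its reverse turn
  this into estimates in \<open>norm z\<close> and \<open>norm w\<close> alone.\<close>

lemma sum_minus_cnj_sum_mult_prod:
  "(z + w) - cnj (z + w) * (z * w) = of_real (1 - (norm w)\<^sup>2) * z + of_real (1 - (norm z)\<^sup>2) * w"
  unfolding one_minus_cnj_mult_self[symmetric] by (simp add: algebra_simps)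

text \<open>If \<open>norm w \<ge> 1\<close>, then \<open>norm z < 1\<close>, and the reverse
  triangle inequality leads to \<open>(1 - norm z) * (1 - norm w) > 0\<close>, which is
  absurd.\<close>

lemma symmetrized_bidisc_aux:
  fixes z w :: complex
  assumes zw: "norm z * norm w < 1"
    and less: "norm ((z + w) - cnj (z + w) * (z * w)) < 1 - (norm (z * w))\<^sup>2"
  shows "norm w < 1"
proof (rule ccontr)
  define a b where "a = norm z" and "b = norm w"
  assume "\<not> norm w < 1"
  hence b: "b \<ge> 1" by (simp add: b_def)
  have ab: "a * b < 1" using zw by (simp add: a_def b_def)
  have a0: "a \<ge> 0" by (simp add: a_def)
  have "a * 1 \<le> a * b" using a0 b by (intro mult_left_mono)
  hence a: "a < 1" using ab by simp
  have a2: "a\<^sup>2 \<le> 1" and b2: "b\<^sup>2 \<ge> 1"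
    using a a0 b by (simp_all add: power_le_one)
  have "norm (of_real (1 - a\<^sup>2) * w) - norm (of_real (b\<^sup>2 - 1) * z) \<le>
      norm (of_real (1 - a\<^sup>2) * w - of_real (b\<^sup>2 - 1) * z)"
    by (rule norm_triangle_ineq2)
  also have "of_real (1 - a\<^sup>2) * w - of_real (b\<^sup>2 - 1) * z = (z + w) - cnj (z + w) * (z * w)"
    unfolding sum_minus_cnj_sum_mult_prod a_def b_def by (simp add: algebra_simps)
  also have "norm (of_real (1 - a\<^sup>2) * w) = (1 - a\<^sup>2) * b"
    using a2 by (simp add: norm_mult b_def del: of_real_diff)
  also have "norm (of_real (b\<^sup>2 - 1) * z) = (b\<^sup>2 - 1) * a"
    using b2 by (simp add: norm_mult a_def del: of_real_diff)
  also have "(1 - a\<^sup>2) * b - (b\<^sup>2 - 1) * a = (a + b) * (1 - a * b)"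
    by (simp add: algebra_simps power2_eq_square)
  finally have "(a + b) * (1 - a * b) < 1 - (a * b)\<^sup>2"
    using less by (simp add: a_def b_def norm_mult)
  also have "\<dots> = (1 + a * b) * (1 - a * b)" by (simp add: algebra_simps power2_eq_square)
  finally have "a + b < 1 + a * b" using ab by simp
  hence "(1 - a) * (1 - b) > 0" by (simp add: algebra_simps)
  thus False using a b by (simp add: zero_less_mult_iff)
qed

text \<open>With \<open>a = norm z\<close> and \<open>b = norm w\<close>, the forward direction
  reduces to \<open>a + b < 1 + a * b\<close>, that is \<open>(1 - a) * (1 - b) > 0\<close>. The
  converse takes for \<open>z\<close> and \<open>w\<close> the two roots of the quadratic with sum
  \<open>s\<close> and product \<open>p\<close>.\<close>

lemma symmetrized_bidisc_iff:
  "(s, p) \<in> symmetrized_bidisc \<longleftrightarrow> norm (s - cnj s * p) < 1 - (norm p)\<^sup>2"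
proof
  assume "(s, p) \<in> symmetrized_bidisc"
  then obtain z w where zw: "s = z + w" "p = z * w" "norm z < 1" "norm w < 1"
    by (auto simp: symmetrized_bidisc_def)
  define a b where "a = norm z" and "b = norm w"
  have ab: "0 \<le> a" "a < 1" "0 \<le> b" "b < 1" using zw by (simp_all add: a_def b_def)
  have ab1: "a * b < 1" using ab by (metis mult.right_neutral mult_strict_mono')
  have "norm (s - cnj s * p) \<le> norm (of_real (1 - b\<^sup>2) * z) + norm (of_real (1 - a\<^sup>2) * w)"
    unfolding zw(1,2) sum_minus_cnj_sum_mult_prod a_def b_def by (rule norm_triangle_ineq)
  also have "norm (of_real (1 - b\<^sup>2) * z) = (1 - b\<^sup>2) * a"
    using ab by (simp add: norm_mult a_def power_le_one del: of_real_diff)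
  also have "norm (of_real (1 - a\<^sup>2) * w) = (1 - a\<^sup>2) * b"
    using ab by (simp add: norm_mult b_def power_le_one del: of_real_diff)
  also have "(1 - b\<^sup>2) * a + (1 - a\<^sup>2) * b = (a + b) * (1 - a * b)"
    by (simp add: algebra_simps power2_eq_square)
  also have "\<dots> < (1 + a * b) * (1 - a * b)"
  proof (rule mult_strict_right_mono)
    have "(1 - a) * (1 - b) > 0" using ab by simp
    thus "a + b < 1 + a * b" by (simp add: algebra_simps)
  qed (use ab1 in simp)
  also have "\<dots> = 1 - (norm p)\<^sup>2"
    by (simp add: zw a_def b_def norm_mult algebra_simps power2_eq_square)
  finally show "norm (s - cnj s * p) < 1 - (norm p)\<^sup>2" .
next
  assume less: "norm (s - cnj s * p) < 1 - (norm p)\<^sup>2"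
  define d where "d = csqrt (s\<^sup>2 - 4 * p)"
  define z w where "z = (s + d) / 2" and "w = (s - d) / 2"
  have s: "s = z + w" by (simp add: z_def w_def field_simps)
  have "z * w = (s\<^sup>2 - d\<^sup>2) / 4" by (simp add: z_def w_def field_simps power2_eq_square)
  hence p: "p = z * w" by (simp add: d_def)
  have "(norm p)\<^sup>2 < 1" using less by (smt (verit) norm_ge_zero)
  hence "norm p < 1" by (simp add: power_less_one_iff abs_square_less_1)
  hence "norm z * norm w < 1" by (simp add: p norm_mult)
  hence "norm w < 1" "norm z < 1"
    using symmetrized_bidisc_aux[of z w] symmetrized_bidisc_aux[of w z] less
    by (simp_all add: s p ac_simps)
  thus "(s, p) \<in> symmetrized_bidisc" using s p by (auto simp: symmetrized_bidisc_def)
qed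

lemma open_symmetrized_bidisc: "open symmetrized_bidisc"
proof -
  have "symmetrized_bidisc =
      {x. norm (fst x - cnj (fst x) * snd x) < 1 - (norm (snd x))\<^sup>2}"
    using symmetrized_bidisc_iff by auto
  also have "open \<dots>"
    by (intro open_Collect_less continuous_intros)
  finally show ?thesis .
qed

lemma symmetrized_bidisc_bounds:
  assumes "(s, p) \<in> symmetrized_bidisc"
  shows "norm (s / 2) < 1" "norm p < 1"
proof -
  obtain z w where zw: "s = z + w" "p = z * w" "norm z < 1" "norm w < 1"
    using assms by (auto simp: symmetrized_bidisc_def)
  show "norm (s / 2) < 1" using norm_triangle_ineq[of z w] zw by (simp add: norm_divide)
  show "norm p < 1" using zw by (simp add: norm_mult) (metis mult.right_neutral mult_strict_mono' norm_ge_zero)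
qed

lemma royal_in_symmetrized_bidisc: "norm t < 1 \<Longrightarrow> (2 * t, t\<^sup>2) \<in> symmetrized_bidisc"
  unfolding symmetrized_bidisc_def by (auto intro!: exI[of _ t] simp: power2_eq_square)

section \<open>Flat geodesics and where they meet the royal variety\<close>

text \<open>Along this disc \<open>s - cnj s * p\<close> collapses to
  \<open>b * (1 - (norm l)^2)\<close>, so the criterion for membership becomes
  \<open>norm b < 1\<close>.\<close>

lemma flat_geodesic_in_symmetrized_bidisc:
  assumes "norm b < 1" "norm l < 1"
  shows "(b + cnj b * l, l) \<in> symmetrized_bidisc"
proof -
  have "(b + cnj b * l) - cnj (b + cnj b * l) * l = b * of_real (1 - (norm l)\<^sup>2)"
    unfolding one_minus_cnj_mult_self[symmetric] by (simp add: algebra_simps)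
  moreover have "(norm l)\<^sup>2 < 1" using assms by (simp add: power_less_one_iff)
  ultimately show ?thesis
    unfolding symmetrized_bidisc_iff using assms by (simp add: norm_mult del: of_real_diff)
qed

text \<open>Eliminating \<open>cnj b\<close> from \<open>s = b + cnj b * p\<close> and its conjugate
  leaves one candidate for \<open>b\<close>, and the criterion for membership says exactly that this
  candidate lies in the disc.\<close>

lemma obtain_flat_geodesic:
  assumes "(s, p) \<in> symmetrized_bidisc"
  obtains b where "norm b < 1" "s = b + cnj b * p"
proof
  define d where "d = 1 - (norm p)\<^sup>2"
  define b where "b = (s - cnj s * p) / of_real d"
  have less: "norm (s - cnj s * p) < d"
    using assms by (simp add: symmetrized_bidisc_iff d_def)
  hence d: "d > 0" by (smt (verit) norm_ge_zero)
  show "norm b < 1" using less d by (simp add: b_def norm_divide)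
  have "b + cnj b * p = (s - cnj s * p + (cnj s - s * cnj p) * p) / of_real d"
    by (simp add: b_def add_divide_distrib)
  also have "s - cnj s * p + (cnj s - s * cnj p) * p = s * (1 - cnj p * p)"
    by (simp add: algebra_simps)
  finally show "s = b + cnj b * p"
    unfolding one_minus_cnj_mult_self using d by (simp add: d_def[symmetric])
qed

text \<open>The last equation places \<open>(2 * t, t^2)\<close> on the geodesic, at parameter
  \<open>t^2\<close>; the middle one expresses \<open>b\<close> through \<open>t\<close> and implies
  the last.\<close>

lemma obtain_flat_geodesic_royal_point:
  fixes b :: complex
  assumes b: "norm b < 1"
  obtains t where "norm t < 1" "b * of_real (1 + (norm t)\<^sup>2) = 2 * t" "b + cnj b * t\<^sup>2 = 2 * t"
proof
  define c where "c = sqrt (1 - (norm b)\<^sup>2)"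
  have b2: "(norm b)\<^sup>2 < 1" using b by (simp add: power_less_one_iff)
  have c: "c > 0" "c\<^sup>2 = 1 - (norm b)\<^sup>2" using b2 by (simp_all add: c_def)
  \<comment> \<open>The solution of \<open>b * (1 + (norm t)^2) = 2 * t\<close> inside the disc,
    written without division by \<open>norm b\<close> so that \<open>b = 0\<close> is
    covered.\<close>
  define t where "t = b / of_real (1 + c)"
  have nt: "norm t = norm b / (1 + c)" using c by (simp add: t_def norm_divide del: of_real_add)
  show t1: "norm t < 1" unfolding nt using b c by (simp add: field_simps)
  have "(norm t)\<^sup>2 = (1 - c\<^sup>2) / (1 + c)\<^sup>2" by (simp add: nt power_divide c)
  also have "\<dots> = ((1 - c) * (1 + c)) / ((1 + c) * (1 + c))"
    by (simp add: algebra_simps power2_eq_square)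
  also have "\<dots> = (1 - c) / (1 + c)" using c(1) by simp
  finally have "1 + (norm t)\<^sup>2 = 2 / (1 + c)" using c(1) by (simp add: field_simps)
  thus *: "b * of_real (1 + (norm t)\<^sup>2) = 2 * t" by (simp add: t_def)
  have nz: "of_real (1 + (norm t)\<^sup>2) \<noteq> (0 :: complex)"
    unfolding of_real_eq_0_iff by (smt (verit) zero_le_power2)
  \<comment> \<open>The conjugate of \<open>*\<close> eliminates \<open>cnj b\<close> once the claim
    is multiplied by the nonzero real number \<open>1 + (norm t)^2\<close>.\<close>
  have "cnj b * of_real (1 + (norm t)\<^sup>2) = cnj (2 * t)"
    unfolding *[symmetric] by simp
  moreover have "(b + cnj b * t\<^sup>2) * of_real (1 + (norm t)\<^sup>2) =
      b * of_real (1 + (norm t)\<^sup>2) + cnj b * of_real (1 + (norm t)\<^sup>2) * t\<^sup>2"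
    by (simp add: algebra_simps del: of_real_add)
  ultimately have "(b + cnj b * t\<^sup>2) * of_real (1 + (norm t)\<^sup>2) = 2 * t + cnj (2 * t) * t\<^sup>2"
    using * by (simp only:)
  also have "\<dots> = 2 * t * of_real (1 + (norm t)\<^sup>2)"
    using complex_norm_square[of t] by (simp add: algebra_simps power2_eq_square)
  finally show "b + cnj b * t\<^sup>2 = 2 * t" using nz by (simp del: of_real_add)
qed

section \<open>Functions that invert the royal parametrisation\<close>

text \<open>The left side is nonnegative exactly when the pseudohyperbolic distance from
  \<open>t\<close> to \<open>k\<close> is at most that from \<open>t^2\<close> to \<open>p\<close>,
  for points of the disc. On the right \<open>a\<close> will be \<open>(1 + r) * (s / 2)\<close>, so
  that a factor \<open>(1 + r)^2\<close> comes out and only \<open>s\<close>, \<open>p\<close> and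
  \<open>k\<close> remain in the difference.\<close>

lemma royal_disc_identity:
  fixes t k p :: complex
  defines "r \<equiv> (norm t)\<^sup>2" and "a \<equiv> t + cnj t * p"
  shows "(norm (p - t\<^sup>2))\<^sup>2 * (norm (1 - cnj t * k))\<^sup>2 - (norm (k - t))\<^sup>2 * (norm (1 - cnj (t\<^sup>2) * p))\<^sup>2
    = (1 - r) * ((norm (of_real (1 + r) * p - k * a))\<^sup>2 - (norm (a - of_real (1 + r) * k))\<^sup>2)"
  unfolding r_def a_def cmod_power2 by (simp add: power2_eq_square) algebra

lemma royal_interpolation_inequality:
  assumes F: "F \<in> disc_valued symmetrized_bidisc"
    and royal: "\<And>t. norm t < 1 \<Longrightarrow> F (2 * t, t\<^sup>2) = t"
    and sp: "(s, p) \<in> symmetrized_bidisc"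
  shows "norm (s / 2 - F (s, p)) \<le> norm (p - F (s, p) * (s / 2))"
proof -
  obtain b where b: "norm b < 1" and s: "s = b + cnj b * p"
    using obtain_flat_geodesic[OF sp] by blast
  obtain t where t: "norm t < 1" and bt: "b * of_real (1 + (norm t)\<^sup>2) = 2 * t"
    and bt2: "b + cnj b * t\<^sup>2 = 2 * t"
    using obtain_flat_geodesic_royal_point[OF b] by blast
  have p: "norm p < 1" using symmetrized_bidisc_bounds[OF sp] by simp
  have t2: "norm (t\<^sup>2) < 1" using t by (simp add: norm_power power_less_one_iff)
  \<comment> \<open>\<open>F\<close> along the geodesic through \<open>(s, p)\<close>: it sends
    \<open>t^2\<close> to \<open>t\<close> and \<open>p\<close> to \<open>F (s, p)\<close>.\<close>
  define f where "f = (\<lambda>l. F (b + cnj b * l, l))"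
  have "f holomorphic_on ball 0 1" unfolding f_def
    by (rule holomorphic_on_compose_pair[OF _ open_symmetrized_bidisc])
      (use F b in \<open>auto simp: disc_valued_def intro!: holomorphic_intros flat_geodesic_in_symmetrized_bidisc\<close>)
  moreover have "f ` ball 0 1 \<subseteq> ball 0 1"
    using F b by (auto simp: disc_valued_def f_def image_subset_iff dest: flat_geodesic_in_symmetrized_bidisc)
  ultimately have "norm (blaschke (f (t\<^sup>2)) (f p)) \<le> norm (blaschke (t\<^sup>2) p)"
    using t2 p by (rule Schwarz_Pick)
  moreover have "f (t\<^sup>2) = t" using royal[OF t] by (simp add: f_def bt2)
  moreover define k where "k = F (s, p)"
  moreover have "f p = k" by (simp add: f_def k_def s)
  ultimately have le: "norm (blaschke t k) \<le> norm (blaschke (t\<^sup>2) p)" by simp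
  have k: "norm k < 1" using F sp by (auto simp: k_def disc_valued_def)
  have "norm (k - t) * norm (1 - cnj (t\<^sup>2) * p) \<le> norm (p - t\<^sup>2) * norm (1 - cnj t * k)"
    using le one_minus_cnj_mult_nonzero[OF t k] one_minus_cnj_mult_nonzero[OF t2 p]
    by (simp add: blaschke_def norm_divide divide_simps mult_ac split: if_splits)
  hence "(norm (k - t))\<^sup>2 * (norm (1 - cnj (t\<^sup>2) * p))\<^sup>2 \<le> (norm (p - t\<^sup>2))\<^sup>2 * (norm (1 - cnj t * k))\<^sup>2"
    unfolding power_mult_distrib[symmetric] by (rule power_mono) simp
  define r a where "r = (norm t)\<^sup>2" and "a = t + cnj t * p"
  have r: "r < 1" "r \<ge> 0" using t by (simp_all add: r_def power_less_one_iff)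
  have "0 \<le> (1 - r) * ((norm (of_real (1 + r) * p - k * a))\<^sup>2 - (norm (a - of_real (1 + r) * k))\<^sup>2)"
    using \<open>(norm (k - t))\<^sup>2 * _ \<le> _\<close> royal_disc_identity[of p t k]
    unfolding r_def a_def by linarith
  hence "(norm (a - of_real (1 + r) * k))\<^sup>2 \<le> (norm (of_real (1 + r) * p - k * a))\<^sup>2"
    using r by (simp add: zero_le_mult_iff)
  hence "norm (a - of_real (1 + r) * k) \<le> norm (of_real (1 + r) * p - k * a)"
    by (rule power2_le_imp_le) simp
  \<comment> \<open>Multiplying \<open>s = b + cnj b * p\<close> by \<open>1 + r\<close> and
    inserting \<open>bt\<close> with its conjugate removes \<open>b\<close>; this brings the
    inequality back from \<open>t\<close> to \<open>s\<close>.\<close>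
  moreover have a: "a = of_real (1 + r) * (s / 2)"
  proof -
    have "cnj b * of_real (1 + r) = cnj (2 * t)"
      unfolding bt[symmetric] r_def by simp
    moreover have "of_real (1 + r) * s = b * of_real (1 + r) + cnj b * of_real (1 + r) * p"
      unfolding s by (simp only: distrib_left mult.assoc mult.commute mult.left_commute)
    ultimately have "of_real (1 + r) * s = 2 * a"
      using bt by (simp add: a_def r_def del: of_real_add)
    thus ?thesis by simp
  qed
  moreover have "a - of_real (1 + r) * k = of_real (1 + r) * (s / 2 - k)"
    "of_real (1 + r) * p - k * a = of_real (1 + r) * (p - k * (s / 2))"
    unfolding a by (simp_all add: algebra_simps)
  ultimately have "(1 + r) * norm (s / 2 - k) \<le> (1 + r) * norm (p - k * (s / 2))"
    using r by (simp only: norm_mult norm_of_real)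
  thus ?thesis using r by (simp add: k_def)
qed

lemma royal_interpolation:
  assumes F: "F \<in> disc_valued symmetrized_bidisc"
    and royal: "\<And>t. norm t < 1 \<Longrightarrow> F (2 * t, t\<^sup>2) = t"
  obtains \<Psi> where "\<Psi> \<in> schur_class symmetrized_bidisc"
    "\<And>s p. (s, p) \<in> symmetrized_bidisc \<Longrightarrow>
      F (s, p) = 1/2 * s + 1/4 * (s\<^sup>2 - 4 * p) * (\<Psi> (s, p) / (1 - 1/2 * s * \<Psi> (s, p)))"
proof -
  let ?G = symmetrized_bidisc
  define D where "D = (\<lambda>x. snd x - F x * (fst x / 2))"
  define N where "N = (\<lambda>x. fst x / 2 - F x)"
  have hF: "F holomorphic2_on ?G" using F by (simp add: disc_valued_def)
  have half: "(\<lambda>x. fst x / 2) holomorphic2_on U" for U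
    by (intro holomorphic2_on_divide holomorphic2_on_fst holomorphic2_on_const) simp
  have hD: "D holomorphic2_on ?G" and hN: "N holomorphic2_on ?G"
    unfolding D_def N_def
    by (intro holomorphic2_on_diff holomorphic2_on_mult half hF holomorphic2_on_snd)+
  have ND: "norm (N x) \<le> norm (D x)" if "x \<in> ?G" for x
    using royal_interpolation_inequality[OF F royal, of "fst x" "snd x"] that
    by (simp add: N_def D_def)
  \<comment> \<open>A zero of \<open>D\<close> is also a zero of \<open>N\<close> by
    \<open>ND\<close>; then \<open>F x = fst x / 2\<close>, and \<open>D x = 0\<close> puts
    \<open>x\<close> on the royal variety.\<close>
  have D_nz: "D x \<noteq> 0" if "x \<in> ?G" "(fst x)\<^sup>2 \<noteq> 4 * snd x" for x
  proof
    assume D0: "D x = 0"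
    hence "N x = 0" using ND[OF that(1)] by simp
    hence "snd x = (fst x / 2) * (fst x / 2)" using D0 by (simp add: N_def D_def)
    thus False using that(2) by (simp add: power2_eq_square mult.commute)
  qed
  \<comment> \<open>In the coordinates \<open>(s, s\<^sup>2 - 4 p)\<close> the royal variety becomes \<open>snd x = 0\<close>; \<open>\<tau>\<close> is the inverse change.\<close>
  define \<tau> where "\<tau> = (\<lambda>x::complex \<times> complex. (fst x, ((fst x)\<^sup>2 - snd x) / 4))"
  define U where "U = \<tau> -` ?G"
  have \<tau>: "fst (\<tau> x) = fst x" "snd (\<tau> x) = ((fst x)\<^sup>2 - snd x) / 4" for x
    by (simp_all add: \<tau>_def)
  have "continuous_on UNIV \<tau>" unfolding \<tau>_def by (intro continuous_intros) auto
  hence U: "open U" unfolding U_def by (intro open_vimage open_symmetrized_bidisc)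
  define U' where "U' = {x \<in> U. snd x \<noteq> 0}"
  have \<tau>_compose: "(\<lambda>x. H (\<tau> x)) holomorphic2_on U'" if "H holomorphic2_on ?G" for H
    unfolding \<tau>_def
    by (rule holomorphic2_on_compose2[OF that _ _ _ open_symmetrized_bidisc])
      (auto intro!: holomorphic2_on_fst holomorphic2_on_divide holomorphic2_on_diff
         holomorphic2_on_mult holomorphic2_on_snd holomorphic2_on_const
         simp: power2_eq_square U'_def U_def \<tau>_def)
  have D\<tau>: "D (\<tau> x) \<noteq> 0" if "x \<in> U" "snd x \<noteq> 0" for x
    using D_nz[of "\<tau> x"] that by (auto simp: U_def \<tau>)
  have "(\<lambda>x. N (\<tau> x) / D (\<tau> x)) holomorphic2_on U'"
    by (intro holomorphic2_on_divide \<tau>_compose hN hD) (auto simp: U'_def D\<tau>)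
  moreover have "norm (N (\<tau> x) / D (\<tau> x)) \<le> 1" if "x \<in> U" "snd x \<noteq> 0" for x
    using ND[of "\<tau> x"] D\<tau>[OF that] that by (simp add: U_def norm_divide)
  ultimately obtain h where h: "h holomorphic2_on U" "\<And>x. x \<in> U \<Longrightarrow> norm (h x) \<le> 1"
    "\<And>x. x \<in> U \<Longrightarrow> snd x \<noteq> 0 \<Longrightarrow> h x = N (\<tau> x) / D (\<tau> x)"
    using holomorphic2_extend_bounded[OF U, of "\<lambda>x. N (\<tau> x) / D (\<tau> x)" 1] unfolding U'_def by blast
  define \<Psi> where "\<Psi> = (\<lambda>x. h (fst x, (fst x)\<^sup>2 - 4 * snd x))"
  have inU: "(fst x, (fst x)\<^sup>2 - 4 * snd x) \<in> U" if "x \<in> ?G" for x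
    using that by (simp add: U_def \<tau>_def)
  show ?thesis
  proof
    have "\<Psi> holomorphic2_on ?G" unfolding \<Psi>_def power2_eq_square
      by (rule holomorphic2_on_compose2[OF h(1) _ _ _ U])
        (auto intro!: holomorphic2_on_fst holomorphic2_on_diff
           holomorphic2_on_mult holomorphic2_on_snd holomorphic2_on_const
           simp: inU[unfolded power2_eq_square])
    thus "\<Psi> \<in> schur_class ?G"
      using h(2)[OF inU] by (auto simp: schur_class_def \<Psi>_def)
    fix s p assume sp: "(s, p) \<in> ?G"
    show "F (s, p) = 1/2 * s + 1/4 * (s\<^sup>2 - 4 * p) * (\<Psi> (s, p) / (1 - 1/2 * s * \<Psi> (s, p)))"
    proof (cases "s\<^sup>2 = 4 * p")
      \<comment> \<open>The factor \<open>s^2 - 4 * p\<close> removes \<open>\<Psi>\<close>, and the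
        claim is the hypothesis \<open>royal\<close> at \<open>t = s / 2\<close>.\<close>
      case True
      have "norm (s / 2) < 1" using symmetrized_bidisc_bounds[OF sp] by simp
      from royal[OF this] True show ?thesis by (simp add: power_divide)
    next
      case False
      hence D: "D (s, p) \<noteq> 0" using D_nz[OF sp] by simp
      have \<Psi>: "\<Psi> (s, p) = N (s, p) / D (s, p)"
        using h(3)[OF inU[OF sp]] False by (simp add: \<Psi>_def \<tau>_def)
      \<comment> \<open>In \<open>D - (s / 2) * N\<close> the terms containing \<open>F\<close>
        cancel, which leaves \<open>p - s^2 / 4\<close>.\<close>
      have "1 - 1/2 * s * \<Psi> (s, p) = (p - s\<^sup>2 / 4) / D (s, p)"
        unfolding \<Psi> using D by (simp add: field_simps) (simp add: D_def N_def field_simps power2_eq_square)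
      hence quot: "\<Psi> (s, p) / (1 - 1/2 * s * \<Psi> (s, p)) = N (s, p) / (p - s\<^sup>2 / 4)"
        unfolding \<Psi> using D by simp
      have q: "p - s\<^sup>2 / 4 \<noteq> 0" using False by (auto simp: mult.commute)
      have "1/4 * (s\<^sup>2 - 4 * p) * (N (s, p) / (p - s\<^sup>2 / 4)) = - N (s, p)"
        using q by (simp add: divide_simps) (simp add: algebra_simps)
      thus ?thesis unfolding quot by (simp add: N_def)
    qed
  qed
qed

section \<open>The extremal problem at a royal tangent\<close>

text \<open>The direction is \<open>c\<close> times the velocity \<open>(2, 2 * z)\<close> of the
  royal parametrisation at \<open>z\<close>, so this is the chain rule.\<close>

lemma dir_deriv_royal:
  assumes F: "F holomorphic2_on symmetrized_bidisc" and z: "norm z < 1"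
  shows "dir_deriv (2 * c * 1, 2 * c * z) F (2 * z, z\<^sup>2) = c * deriv (\<lambda>t. F (2 * t, t\<^sup>2)) z"
proof -
  obtain a b where ab: "(F has_derivative (\<lambda>v. a * fst v + b * snd v)) (at (2 * z, z\<^sup>2))"
    using F royal_in_symmetrized_bidisc[OF z] holomorphic2_on_open[OF open_symmetrized_bidisc] by blast
  have "((\<lambda>t. F (t, z\<^sup>2)) has_field_derivative a * 1 + b * 0) (at (2 * z))"
    by (rule has_field_derivative_compose_pair[where f = "\<lambda>t. t" and g = "\<lambda>_. z\<^sup>2", OF ab DERIV_ident DERIV_const])
  moreover have "((\<lambda>t. F (2 * z, t)) has_field_derivative a * 0 + b * 1) (at (z\<^sup>2))"
    by (rule has_field_derivative_compose_pair[where f = "\<lambda>_. 2 * z" and g = "\<lambda>t. t", OF ab DERIV_const DERIV_ident])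
  moreover have "((\<lambda>t. F (2 * t, t\<^sup>2)) has_field_derivative a * 2 + b * (2 * z)) (at z)"
    by (rule has_field_derivative_compose_pair[where f = "\<lambda>t. 2 * t" and g = "\<lambda>t. t\<^sup>2", OF ab])
      (auto intro!: derivative_eq_intros)
  ultimately show ?thesis
    by (simp add: dir_deriv_def DERIV_imp_deriv algebra_simps)
qed

lemma royal_restriction:
  assumes F: "F \<in> disc_valued symmetrized_bidisc"
  shows "(\<lambda>t. F (2 * t, t\<^sup>2)) holomorphic_on ball 0 1"
    and "(\<lambda>t. F (2 * t, t\<^sup>2)) ` ball 0 1 \<subseteq> ball 0 1"
proof -
  show "(\<lambda>t. F (2 * t, t\<^sup>2)) holomorphic_on ball 0 1"
    by (rule holomorphic_on_compose_pair[OF _ open_symmetrized_bidisc])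
      (use F in \<open>auto simp: disc_valued_def intro!: holomorphic_intros royal_in_symmetrized_bidisc\<close>)
  show "(\<lambda>t. F (2 * t, t\<^sup>2)) ` ball 0 1 \<subseteq> ball 0 1"
    using F royal_in_symmetrized_bidisc by (fastforce simp: disc_valued_def image_subset_iff)
qed

lemma car_quotient_royal:
  assumes F: "F \<in> disc_valued symmetrized_bidisc" and z: "norm z < 1"
  shows "car_quotient ((2 * z, z\<^sup>2), (2 * c * 1, 2 * c * z)) F =
    norm c * (norm (deriv (\<lambda>t. F (2 * t, t\<^sup>2)) z) / (1 - (norm (F (2 * z, z\<^sup>2)))\<^sup>2))"
  using dir_deriv_royal[OF _ z, of F c] F
  by (simp add: car_quotient_def disc_valued_def norm_mult)

text \<open>Schwarz-Pick for the restriction to the royal variety bounds every quotient; the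
  function \<open>s / 2\<close> attains the bound because its restriction is the identity.\<close>

lemma car_norm_royal:
  assumes z: "norm z < 1"
  shows "car_norm ((2 * z, z\<^sup>2), (2 * c * 1, 2 * c * z)) = ereal (norm c * (1 / (1 - (norm z)\<^sup>2)))"
    (is "car_norm ?\<delta> = ereal ?K")
proof (rule antisym)
  show "car_norm ?\<delta> \<le> ereal ?K"
    unfolding car_norm_def
  proof (rule SUP_least)
    fix F assume F: "F \<in> disc_valued symmetrized_bidisc"
    from Schwarz_Pick(2)[OF royal_restriction[OF F] z]
    have "car_quotient ?\<delta> F \<le> ?K"
      unfolding car_quotient_royal[OF F z] by (rule mult_left_mono) simp
    thus "ereal (car_quotient ?\<delta> F) \<le> ereal ?K" by simp
  qed
  define F where "F = (\<lambda>x::complex \<times> complex. fst x / 2)"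
  have "F holomorphic2_on symmetrized_bidisc"
    unfolding F_def by (intro holomorphic2_on_divide holomorphic2_on_fst holomorphic2_on_const) simp
  hence F: "F \<in> disc_valued symmetrized_bidisc"
    using symmetrized_bidisc_bounds(1) by (auto simp: disc_valued_def F_def)
  have "car_quotient ?\<delta> F = ?K"
    unfolding car_quotient_royal[OF F z] by (simp add: F_def)
  thus "ereal ?K \<le> car_norm ?\<delta>"
    unfolding car_norm_def using SUP_upper[OF F, of "\<lambda>F. ereal (car_quotient ?\<delta> F)"] by simp
qed

text \<open>Since \<open>c \<noteq> 0\<close>, the factor \<open>norm c\<close> cancels, and
  attaining the supremum becomes equality in Schwarz-Pick, which characterises
  automorphisms.\<close>

lemma solves_Car_royal_iff:
  assumes F: "F \<in> disc_valued symmetrized_bidisc" and z: "norm z < 1" and c: "c \<noteq> 0"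
  shows "solves_Car F ((2 * z, z\<^sup>2), (2 * c * 1, 2 * c * z)) \<longleftrightarrow>
    disc_automorphism (\<lambda>t. F (2 * t, t\<^sup>2))"
proof -
  let ?f = "\<lambda>t. F (2 * t, t\<^sup>2)"
  have "solves_Car F ((2 * z, z\<^sup>2), (2 * c * 1, 2 * c * z)) \<longleftrightarrow>
      norm (deriv ?f z) / (1 - (norm (?f z))\<^sup>2) = 1 / (1 - (norm z)\<^sup>2)"
    unfolding solves_Car_def car_norm_royal[OF z] car_quotient_royal[OF F z]
    using F c by (simp only: ereal.inject mult_cancel_left norm_eq_zero simp_thms)
  also have "\<dots> \<longleftrightarrow> disc_automorphism ?f"
    using Schwarz_Pick_equality[OF royal_restriction[OF F] z]
      disc_automorphism_Schwarz_Pick_equality[of ?f, OF _ z] by blast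
  finally show ?thesis .
qed

theorem theorem3p1:
  fixes z c :: complex and \<delta> :: tangent and \<phi> :: "complex \<times> complex \<Rightarrow> complex"
  assumes "z \<in> unit_disc" and "c \<noteq> 0"
    and "\<delta> = ((2 * z, z\<^sup>2), (2 * c * 1, 2 * c * z))"
    and "\<phi> \<in> disc_valued symmetrized_bidisc"
  shows "solves_Car \<phi> \<delta> \<longleftrightarrow>
    (\<exists>m \<Psi>. disc_automorphism m \<and> \<Psi> \<in> schur_class symmetrized_bidisc \<and>
      (\<forall>(s1, s2) \<in> symmetrized_bidisc.
        \<phi> (s1, s2) =
          m (1/2 * s1 + 1/4 * (s1\<^sup>2 - 4 * s2) * (\<Psi> (s1, s2) / (1 - 1/2 * s1 * \<Psi> (s1, s2))))))"
    (is "_ \<longleftrightarrow> ?R")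
proof -
  define f where "f = (\<lambda>t. \<phi> (2 * t, t\<^sup>2))"
  have z: "norm z < 1" using assms(1) by simp
  have "solves_Car \<phi> \<delta> \<longleftrightarrow> disc_automorphism f"
    unfolding assms(3) f_def by (rule solves_Car_royal_iff[OF assms(4) z assms(2)])
  also have "disc_automorphism f \<longleftrightarrow> ?R"
  proof
    assume f_aut: "disc_automorphism f"
    define k where "k = inv_into unit_disc f"
    note f = disc_automorphismD[OF f_aut, folded k_def]
    \<comment> \<open>Composing with the inverse of \<open>f\<close> normalises
      \<open>\<phi>\<close> to the identity on the royal variety; the automorphism \<open>m\<close>
      of the claim is then \<open>f\<close> itself.\<close>
    define F where "F = (\<lambda>x. k (\<phi> x))"
    have \<phi>: "\<phi> holomorphic2_on symmetrized_bidisc" "\<phi> ` symmetrized_bidisc \<subseteq> ball 0 1"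
      using assms(4) by (simp_all add: disc_valued_def)
    have "F holomorphic2_on symmetrized_bidisc"
      unfolding F_def by (rule holomorphic2_on_compose1[OF \<phi>(1) f(2) open_ball \<phi>(2)])
    hence F: "F \<in> disc_valued symmetrized_bidisc"
      using \<phi>(2) f(4) by (auto simp: disc_valued_def F_def image_subset_iff)
    have "F (2 * t, t\<^sup>2) = t" if "norm t < 1" for t
      using f(5)[OF that] by (simp add: F_def f_def)
    then obtain \<Psi> where \<Psi>: "\<Psi> \<in> schur_class symmetrized_bidisc"
      "\<And>s p. (s, p) \<in> symmetrized_bidisc \<Longrightarrow>
        F (s, p) = 1/2 * s + 1/4 * (s\<^sup>2 - 4 * p) * (\<Psi> (s, p) / (1 - 1/2 * s * \<Psi> (s, p)))"
      using royal_interpolation[OF F] by blast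
    have "\<phi> (s, p) = f (F (s, p))" if "(s, p) \<in> symmetrized_bidisc" for s p
      using f(6)[of "\<phi> (s, p)"] \<phi>(2) that by (auto simp: F_def image_subset_iff)
    thus ?R using f_aut \<Psi> by (intro exI[of _ f] exI[of _ \<Psi>]) auto
  next
    assume ?R
    then obtain m \<Psi> where m: "disc_automorphism m" and eq: "\<And>s1 s2. (s1, s2) \<in> symmetrized_bidisc \<Longrightarrow>
        \<phi> (s1, s2) = m (1/2 * s1 + 1/4 * (s1\<^sup>2 - 4 * s2) * (\<Psi> (s1, s2) / (1 - 1/2 * s1 * \<Psi> (s1, s2))))"
      by blast
    note mD = disc_automorphismD[OF m]
    \<comment> \<open>At \<open>(2 * t, t^2)\<close> the factor \<open>s1^2 - 4 * s2\<close>
      vanishes, so the formula reduces to \<open>m t\<close> whatever \<open>\<Psi>\<close>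
      is.\<close>
    have fm: "f t = m t" if "norm t < 1" for t
      using eq[OF royal_in_symmetrized_bidisc[OF that]] by (simp add: f_def power_mult_distrib)
    \<comment> \<open>\<open>f\<close> and \<open>m\<close> are known to agree only on the disc, so
      the property is transferred by way of the inverse of \<open>m\<close>.\<close>
    show "disc_automorphism f"
      by (rule disc_automorphismI[where k = "inv_into unit_disc m"])
        (use royal_restriction(1)[OF assms(4)] mD fm in \<open>simp_all add: f_def[symmetric]\<close>)
  qed
  finally show ?thesis .
qed

end
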